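(* Let $(\mathscr{G},\circ)$ be a dynamical group over $\Lambda$, $(\mathscr{H},\cdot)$ a constant dynamical group over $\Lambda$, $\{\Phi_\lambda:G\to\mathrm{Bij}(H)\}_{\lambda\in\Lambda}$ an action of $\mathscr{G}$ on $\mathscr{H}$, and $\mathcal{B}:H\to G$ a map. For $\lambda\in\Lambda$ let $\xi^\lambda_{\mathcal{B}}:H\times G\to H\times G$ be the bijection $\xi^\lambda_{\mathcal{B}}(x,a)=(x,\mathcal{B}(x)\circ_\lambda a)$, put $\widetilde{\phi_{\mathcal{B}}}(\lambda,x,a)=\phi_G(\lambda,\mathcal{B}(x)\circ_\lambda a)$, and define $$(x,a)\ast^{\mathcal{B}}_\lambda(y,b)=(\xi^\lambda_{\mathcal{B}})^{-1}\Big(\xi^\lambda_{\mathcal{B}}(x,a)\rtimes_\lambda\xi^{\lambda}_{\mathcal{B}}(y,b)\Big)=\Big(z,\ \overline{\mathcal{B}(z)}^{\lambda}\circ_{\phi_G(\lambda,\mathcal{B}(z))}\big((\mathcal{B}(x)\circ_\lambda a)\circ_\lambda(\mathcal{B}(y)\circ_\lambda b)\big)\Big),\qquad z=x\cdot_\lambda\Phi_\lambda(\mathcal{B}(x)\circ_\lambda a)(y),$$ where $(x,a)\rtimes_\lambda(y,b)=(x\cdot_\lambda\Phi_\lambda(a)(y),a\circ_\lambda b)$ is the semi-direct product. Then $(H\times G,\Lambda,\widetilde{\phi_{\mathcal{B}}},\{\ast^{\mathcal{B}}_\lambda\}_{\lambda\in\Lambda})$ is a dynamical group factorization into the dynamical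 subgroups $H\times\{e_G\}$ and $\{e_H\}\times G$ if and only if $\mathcal{B}$ is a relative Rota-Baxter operator on the dynamical group $(\mathscr{G},\circ)$ with respect to the action $\{\Phi_\lambda\}_{\lambda\in\Lambda}$.
   Context: Fix a set $\Lambda$. A dynamical set is a triple $(X,\Lambda,\phi_X)$ with $X$ a set and $\phi_X:\Lambda\times X\to\Lambda$ a map. Dynamical group: a dynamical set $\mathscr{G}=(G,\Lambda,\phi_G)$ with maps $\circ_\lambda:G\times G\to G$ ($\lambda\in\Lambda$) such that $\phi_G(\lambda,a\circ_\lambda b)=\phi_G(\phi_G(\lambda,a),b)$ and $a\circ_\lambda(b\circ_{\phi_G(\lambda,a)}c)=(a\circ_\lambda b)\circ_\lambda c$; an element $e_G$ with $a\circ_\lambda e_G=e_G\circ_\lambda a=a$ and $\phi_G(\lambda,e_G)=\lambda$; and for all $\lambda,a$ an element $\bar a^\lambda$ with $a\circ_\lambda\bar a^\lambda=\bar a^\lambda\circ_{\phi_G(\lambda,a)}a=e_G$. A constant dynamical group is a dynamical group $(\mathscr{H},\cdot)$ with $\phi_H(\lambda,x)=\lambda$ (i.e. a family of group structures $\cdot_\lambda$ on $H$ with common unit $e_H$); $x^\lambda$ denotes the inverse of $x$ for $\cdot_\lambda$. A dynamical subgroup is a subset (with restricted structure map) containing the unit and closed under all products $\circ_\lambda$ and all inverses $a\mapsto\bar a^\lambda$. Action of $\mathscr{G}$ on a constant dynamical group $\mathscr{H}$: maps $\Phi_\lambda:G\to\mathrm{Bij}(H)$ (bijections of the set $H$) with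 $\Phi_\lambda(a)(x\cdot_{\phi_G(\lambda,a)}y)=(\Phi_\lambda(a)x)\cdot_\lambda(\Phi_\lambda(a)y)$ and $\Phi_\lambda(a\circ_\lambda b)=\Phi_\lambda(a)\Phi_{\phi_G(\lambda,a)}(b)$. The semi-direct product $\mathscr{H}\rtimes_\Phi\mathscr{G}$ is the dynamical group on $H\times G$ with products $\rtimes_\lambda$ and structure map $(\lambda,x,a)\mapsto\phi_G(\lambda,a)$. The inverse of $\xi^\lambda_{\mathcal{B}}$ is $(x,a)\mapsto(x,\overline{\mathcal{B}(x)}^\lambda\circ_{\phi_G(\lambda,\mathcal{B}(x))}a)$. The structure $(H\times G,\Lambda,\widetilde{\phi_{\mathcal{B}}},\{\ast^{\mathcal{B}}_\lambda\})$ is presented as the pull-back of the dynamical group $\mathscr{H}\rtimes_\Phi\mathscr{G}$ along $\xi_{\mathcal{B}}$, with unit $(e_H,\overline{\mathcal{B}(e_H)}^\lambda)$ and with the inverse of $(x,a)$ given by $\big(w,\ \overline{\mathcal{B}(w)}^\lambda\circ_{\phi_G(\lambda,\mathcal{B}(w))}\overline{\mathcal{B}(x)\circ_\lambda a}^\lambda\big)$, $w=\Phi_\lambda(\mathcal{B}(x)\circ_\lambda a)^{-1}(x^\lambda)$. Factorization: a dynamical group $(K,\Lambda,\phi_K,\{\ast_\lambda\})$ is factorized into $A,B\subseteq K$ if $A$ and $B$ are dynamical subgroups, for every $\lambda\in\Lambda$ every $k\in K$ is of the form $k=u\ast_\lambda v$ with $u\in A$, $v\in B$, and $A\cap B$ consists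 of the unit only. Relative Rota-Baxter operator: a map $\mathcal{B}:H\to G$ with $\mathcal{B}(x)\circ_\lambda\mathcal{B}(y)=\mathcal{B}(x\cdot_\lambda\Phi_\lambda(\mathcal{B}(x))(y))$ for all $\lambda\in\Lambda$, $x,y\in H$.
   Formalization: With the displayed product the dynamical group axioms can fail even if B is Rota-Baxter; so "dynamical group" for H×G here means only the pull-back of the semi-direct product along the maps ξ at each λ, and the factorization does not include those axioms. *)

theory Defs
  imports "HOL-Library.FuncSet" "HOL-Algebra.Congruence"
begin

text \<open>
  The operations of a dynamical structure over a parameter set \<open>Lam\<close>: the structure map \<open>str\<close>, the
  products \<open>prd l\<close>, the units \<open>one l\<close> and the inverses \<open>dinv l\<close>.  The unit carries an index because
  the pull-back of a dynamical group along a family of bijections has the unit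
  \<open>(e\<^sub>H, dinv G l (B e\<^sub>H))\<close>, which may depend on \<open>l\<close>; in a dynamical group it is a single element.
\<close>

record ('l, 'a) dynamical_struct = "'a partial_object" +
  str  :: "'l \<Rightarrow> 'a \<Rightarrow> 'l"
  prd  :: "'l \<Rightarrow> 'a \<Rightarrow> 'a \<Rightarrow> 'a"
  one  :: "'l \<Rightarrow> 'a"
  dinv :: "'l \<Rightarrow> 'a \<Rightarrow> 'a"

definition dynamical_group :: "'l set \<Rightarrow> ('l, 'a) dynamical_struct \<Rightarrow> 'a \<Rightarrow> bool" where
  "dynamical_group Lam G e \<longleftrightarrow>
     e \<in> carrier G \<and>
     (\<forall>l\<in>Lam. one G l = e) \<and>
     (\<forall>l\<in>Lam. \<forall>a\<in>carrier G. str G l a \<in> Lam) \<and>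
     (\<forall>l\<in>Lam. \<forall>a\<in>carrier G. \<forall>b\<in>carrier G. prd G l a b \<in> carrier G) \<and>
     (\<forall>l\<in>Lam. \<forall>a\<in>carrier G. dinv G l a \<in> carrier G) \<and>
     (\<forall>l\<in>Lam. \<forall>a\<in>carrier G. \<forall>b\<in>carrier G. str G l (prd G l a b) = str G (str G l a) b) \<and>
     (\<forall>l\<in>Lam. \<forall>a\<in>carrier G. \<forall>b\<in>carrier G. \<forall>c\<in>carrier G.
        prd G l a (prd G (str G l a) b c) = prd G l (prd G l a b) c) \<and>
     (\<forall>l\<in>Lam. \<forall>a\<in>carrier G. prd G l a e = a \<and> prd G l e a = a) \<and>
     (\<forall>l\<in>Lam. str G l e = l) \<and>
     (\<forall>l\<in>Lam. \<forall>a\<in>carrier G.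
        prd G l a (dinv G l a) = e \<and> prd G (str G l a) (dinv G l a) a = e)"

definition constant_dynamical_group :: "'l set \<Rightarrow> ('l, 'a) dynamical_struct \<Rightarrow> 'a \<Rightarrow> bool" where
  "constant_dynamical_group Lam H e \<longleftrightarrow>
     dynamical_group Lam H e \<and> (\<forall>l\<in>Lam. \<forall>x\<in>carrier H. str H l x = l)"

definition dynamical_action ::
  "'l set \<Rightarrow> ('l, 'g) dynamical_struct \<Rightarrow> ('l, 'h) dynamical_struct \<Rightarrow> ('l \<Rightarrow> 'g \<Rightarrow> 'h \<Rightarrow> 'h) \<Rightarrow> bool"
where
  "dynamical_action Lam G H Phi \<longleftrightarrow>
     (\<forall>l\<in>Lam. \<forall>a\<in>carrier G. bij_betw (Phi l a) (carrier H) (carrier H)) \<and>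
     (\<forall>l\<in>Lam. \<forall>a\<in>carrier G. \<forall>x\<in>carrier H. \<forall>y\<in>carrier H.
        Phi l a (prd H (str G l a) x y) = prd H l (Phi l a x) (Phi l a y)) \<and>
     (\<forall>l\<in>Lam. \<forall>a\<in>carrier G. \<forall>b\<in>carrier G. \<forall>x\<in>carrier H.
        Phi l (prd G l a b) x = Phi l a (Phi (str G l a) b x))"

definition semidirect ::
  "('l, 'h) dynamical_struct \<Rightarrow> ('l, 'g) dynamical_struct \<Rightarrow> ('l \<Rightarrow> 'g \<Rightarrow> 'h \<Rightarrow> 'h)
     \<Rightarrow> ('l, 'h \<times> 'g) dynamical_struct"
where
  "semidirect H G Phi =
    \<lparr>carrier = carrier H \<times> carrier G,
     str = (\<lambda>l (x, a). str G l a),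
     prd = (\<lambda>l (x, a) (y, b). (prd H l x (Phi l a y), prd G l a b)),
     one = (\<lambda>l. (one H l, one G l)),
     dinv = (\<lambda>l (x, a). (inv_into (carrier H) (Phi l a) (dinv H l x), dinv G l a))\<rparr>"

definition relative_rota_baxter ::
  "'l set \<Rightarrow> ('l, 'g) dynamical_struct \<Rightarrow> ('l, 'h) dynamical_struct \<Rightarrow> ('l \<Rightarrow> 'g \<Rightarrow> 'h \<Rightarrow> 'h)
     \<Rightarrow> ('h \<Rightarrow> 'g) \<Rightarrow> bool"
where
  "relative_rota_baxter Lam G H Phi B \<longleftrightarrow>
     B \<in> carrier H \<rightarrow> carrier G \<and>
     (\<forall>l\<in>Lam. \<forall>x\<in>carrier H. \<forall>y\<in>carrier H.
        prd G l (B x) (B y) = B (prd H l x (Phi l (B x) y)))"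

definition xi :: "('l, 'g) dynamical_struct \<Rightarrow> ('h \<Rightarrow> 'g) \<Rightarrow> 'l \<Rightarrow> 'h \<times> 'g \<Rightarrow> 'h \<times> 'g" where
  "xi G B l = (\<lambda>(x, a). (x, prd G l (B x) a))"

definition xi_inv :: "('l, 'g) dynamical_struct \<Rightarrow> ('h \<Rightarrow> 'g) \<Rightarrow> 'l \<Rightarrow> 'h \<times> 'g \<Rightarrow> 'h \<times> 'g" where
  "xi_inv G B l = (\<lambda>(x, a). (x, prd G (str G l (B x)) (dinv G l (B x)) a))"

text \<open>
  The structure on \<open>H \<times> G\<close> attached to \<open>B\<close>.  In a product both factors are moved by \<open>xi\<close> at the same
  parameter \<open>l\<close> (the second one not at the shifted parameter \<open>str G l (prd G l (B x) a)\<close>).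
\<close>

definition rb_struct ::
  "('l, 'h) dynamical_struct \<Rightarrow> ('l, 'g) dynamical_struct \<Rightarrow> ('l \<Rightarrow> 'g \<Rightarrow> 'h \<Rightarrow> 'h)
     \<Rightarrow> ('h \<Rightarrow> 'g) \<Rightarrow> ('l, 'h \<times> 'g) dynamical_struct"
where
  "rb_struct H G Phi B =
    \<lparr>carrier = carrier H \<times> carrier G,
     str = (\<lambda>l (x, a). str G l (prd G l (B x) a)),
     prd = (\<lambda>l (x, a) (y, b).
       let z = prd H l x (Phi l (prd G l (B x) a) y)
       in (z, prd G (str G l (B z)) (dinv G l (B z))
                (prd G l (prd G l (B x) a) (prd G l (B y) b)))),
     one = (\<lambda>l. (one H l, dinv G l (B (one H l)))),
     dinv = (\<lambda>l (x, a).
       let w = inv_into (carrier H) (Phi l (prd G l (B x) a)) (dinv H l x)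
       in (w, prd G (str G l (B w)) (dinv G l (B w)) (dinv G l (prd G l (B x) a))))\<rparr>"

text \<open>
  \<open>K\<close> is the pull-back of the dynamical group \<open>D\<close> along the bijections \<open>f l\<close>, with inverses \<open>g l\<close>:
  for each \<open>l\<close> the operations of \<open>D\<close> at \<open>l\<close> are transported by \<open>f l\<close>.  This is the sense in which
  \<open>rb_struct\<close> is a dynamical group for an arbitrary map \<open>B\<close>.  It is weaker than \<open>dynamical_group\<close>,
  since the axioms there relate operations at different parameters.
\<close>

definition pullback_dynamical_group ::
  "'l set \<Rightarrow> ('l, 'k) dynamical_struct \<Rightarrow> ('l \<Rightarrow> 'k \<Rightarrow> 'd) \<Rightarrow> ('l \<Rightarrow> 'd \<Rightarrow> 'k)
     \<Rightarrow> ('l, 'd) dynamical_struct \<Rightarrow> 'd \<Rightarrow> bool"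
where
  "pullback_dynamical_group Lam K f g D e \<longleftrightarrow>
     dynamical_group Lam D e \<and>
     (\<forall>l\<in>Lam. bij_betw (f l) (carrier K) (carrier D)) \<and>
     (\<forall>l\<in>Lam. \<forall>d\<in>carrier D. g l d \<in> carrier K \<and> f l (g l d) = d) \<and>
     (\<forall>l\<in>Lam. \<forall>k\<in>carrier K. str K l k = str D l (f l k)) \<and>
     (\<forall>l\<in>Lam. \<forall>k\<in>carrier K. \<forall>m\<in>carrier K. prd K l k m = g l (prd D l (f l k) (f l m))) \<and>
     (\<forall>l\<in>Lam. one K l = g l e) \<and>
     (\<forall>l\<in>Lam. \<forall>k\<in>carrier K. dinv K l k = g l (dinv D l (f l k)))"

definition dynamical_subgroup :: "'l set \<Rightarrow> ('l, 'k) dynamical_struct \<Rightarrow> 'k set \<Rightarrow> bool" where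
  "dynamical_subgroup Lam K A \<longleftrightarrow>
     A \<subseteq> carrier K \<and>
     (\<forall>l\<in>Lam. one K l \<in> A) \<and>
     (\<forall>l\<in>Lam. \<forall>a\<in>A. \<forall>b\<in>A. prd K l a b \<in> A) \<and>
     (\<forall>l\<in>Lam. \<forall>a\<in>A. dinv K l a \<in> A)"

definition factorized_into ::
  "'l set \<Rightarrow> ('l, 'k) dynamical_struct \<Rightarrow> 'k set \<Rightarrow> 'k set \<Rightarrow> bool"
where
  "factorized_into Lam K A B \<longleftrightarrow>
     dynamical_subgroup Lam K A \<and> dynamical_subgroup Lam K B \<and>
     (\<forall>l\<in>Lam. \<forall>k\<in>carrier K. \<exists>u\<in>A. \<exists>v\<in>B. k = prd K l u v) \<and>
     (\<forall>l\<in>Lam. A \<inter> B = {one K l})"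

end

theory Submission
  imports Defs
begin

text \<open>
  Everything rests on left cancellation at one parameter: since
  \<open>\<phi>(\<phi>(l, a), a\<inverse>) = l\<close>, associativity gives \<open>a\<inverse> \<circ> (a \<circ>\<^sub>l b) = b\<close>, where the outer product is
  taken at \<open>\<phi>(l, a)\<close>. Hence \<open>xi_inv\<close> inverts \<open>xi\<close>. The product of \<open>(x, e)\<close> and \<open>(y, e)\<close> has
  second component \<open>(B z)\<inverse> \<circ> (B x \<circ>\<^sub>l B y)\<close> with \<open>z = x \<cdot>\<^sub>l \<Phi>\<^sub>l(B x) y\<close>, which is the unit exactly when
  \<open>B x \<circ>\<^sub>l B y = B z\<close>, so closure of \<open>H \<times> {e}\<close> under products is the Rota-Baxter identity. The
  remaining conditions follow from it, with \<open>(x, a) = (x, e) * (e, a)\<close>.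
\<close>

section \<open>Cancellation in a dynamical group at a fixed parameter\<close>

context
  fixes Lam :: "'l set" and G :: "('l, 'g) dynamical_struct" and e :: 'g
  assumes G: "dynamical_group Lam G e"
begin

lemma dg_unit_closed: "e \<in> carrier G"
  using G by (simp add: dynamical_group_def)

lemma dg_one: "l \<in> Lam \<Longrightarrow> one G l = e"
  using G by (simp add: dynamical_group_def)

lemma dg_str_closed: "l \<in> Lam \<Longrightarrow> a \<in> carrier G \<Longrightarrow> str G l a \<in> Lam"
  using G by (simp add: dynamical_group_def)

lemma dg_prd_closed:
  "l \<in> Lam \<Longrightarrow> a \<in> carrier G \<Longrightarrow> b \<in> carrier G \<Longrightarrow> prd G l a b \<in> carrier G"
  using G by (simp add: dynamical_group_def)

lemma dg_dinv_closed: "l \<in> Lam \<Longrightarrow> a \<in> carrier G \<Longrightarrow> dinv G l a \<in> carrier G"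
  using G by (simp add: dynamical_group_def)

lemma dg_str_prd:
  "l \<in> Lam \<Longrightarrow> a \<in> carrier G \<Longrightarrow> b \<in> carrier G \<Longrightarrow> str G l (prd G l a b) = str G (str G l a) b"
  using G by (simp add: dynamical_group_def)

lemma dg_assoc:
  "l \<in> Lam \<Longrightarrow> a \<in> carrier G \<Longrightarrow> b \<in> carrier G \<Longrightarrow> c \<in> carrier G \<Longrightarrow>
    prd G l (prd G l a b) c = prd G l a (prd G (str G l a) b c)"
  using G by (simp add: dynamical_group_def)

lemma dg_unit_right: "l \<in> Lam \<Longrightarrow> a \<in> carrier G \<Longrightarrow> prd G l a e = a"
  using G by (simp add: dynamical_group_def)

lemma dg_unit_left: "l \<in> Lam \<Longrightarrow> a \<in> carrier G \<Longrightarrow> prd G l e a = a"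
  using G by (simp add: dynamical_group_def)

lemma dg_str_unit: "l \<in> Lam \<Longrightarrow> str G l e = l"
  using G by (simp add: dynamical_group_def)

lemma dg_inv_right: "l \<in> Lam \<Longrightarrow> a \<in> carrier G \<Longrightarrow> prd G l a (dinv G l a) = e"
  using G by (simp add: dynamical_group_def)

lemma dg_inv_left: "l \<in> Lam \<Longrightarrow> a \<in> carrier G \<Longrightarrow> prd G (str G l a) (dinv G l a) a = e"
  using G by (simp add: dynamical_group_def)

lemmas dg_simps = dg_unit_closed dg_one dg_str_closed dg_prd_closed dg_dinv_closed
  dg_str_prd dg_unit_right dg_unit_left dg_str_unit dg_inv_right dg_inv_left

text \<open>Apply the structure map to \<open>a\<close> times its inverse, which is the unit, and
  the unit fixes \<open>l\<close>. So a product at \<open>str G l a\<close> that starts with the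
  inverse continues at \<open>l\<close>.\<close>

lemma dg_str_str_inv:
  assumes "l \<in> Lam" "a \<in> carrier G"
  shows "str G (str G l a) (dinv G l a) = l"
  using dg_str_prd[of l a "dinv G l a"] assms by (simp add: dg_simps)

lemma dg_inv_prd_cancel:
  assumes "l \<in> Lam" "a \<in> carrier G" "b \<in> carrier G"
  shows "prd G (str G l a) (dinv G l a) (prd G l a b) = b"
  using dg_assoc[of "str G l a" "dinv G l a" a b] assms by (simp add: dg_simps dg_str_str_inv)

lemma dg_prd_inv_cancel:
  assumes "l \<in> Lam" "a \<in> carrier G" "b \<in> carrier G"
  shows "prd G l a (prd G (str G l a) (dinv G l a) b) = b"
  using dg_assoc[of l a "dinv G l a" b] assms by (simp add: dg_simps)

lemma dg_left_cancel:
  assumes "l \<in> Lam" "a \<in> carrier G" "b \<in> carrier G" "c \<in> carrier G" "prd G l a b = prd G l a c"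
  shows "b = c"
  using dg_inv_prd_cancel assms by metis

text \<open>Cancel \<open>a\<close> against \<open>prd G l a e\<close>. This identifies the images
  of units under the action and under \<open>B\<close>.\<close>

lemma dg_idempotent:
  assumes "l \<in> Lam" "a \<in> carrier G" "prd G l a a = a"
  shows "a = e"
  using dg_left_cancel[of l a a e] assms by (simp add: dg_simps)

lemma dg_inv_unique:
  assumes "l \<in> Lam" "a \<in> carrier G" "b \<in> carrier G" "prd G l a b = e"
  shows "dinv G l a = b"
  using dg_left_cancel[of l a "dinv G l a" b] assms by (simp add: dg_simps)

lemma dg_inv_unit: "l \<in> Lam \<Longrightarrow> dinv G l e = e"
  by (rule dg_inv_unique) (simp_all add: dg_simps)

end

section \<open>Actions and the semi-direct product\<close>

context
  fixes Lam :: "'l set"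
    and G :: "('l, 'g) dynamical_struct" and eG :: 'g
    and H :: "('l, 'h) dynamical_struct" and eH :: 'h
    and Phi :: "'l \<Rightarrow> 'g \<Rightarrow> 'h \<Rightarrow> 'h"
  assumes G: "dynamical_group Lam G eG"
    and cH: "constant_dynamical_group Lam H eH"
    and act: "dynamical_action Lam G H Phi"
begin

lemma constant_dg: "dynamical_group Lam H eH"
  using cH by (simp add: constant_dynamical_group_def)

lemma constant_str: "l \<in> Lam \<Longrightarrow> x \<in> carrier H \<Longrightarrow> str H l x = l"
  using cH by (simp add: constant_dynamical_group_def)

lemmas G_simps = dg_simps[OF G] dg_inv_prd_cancel[OF G] dg_prd_inv_cancel[OF G] dg_inv_unit[OF G]
lemmas H_simps = dg_unit_closed[OF constant_dg] dg_one[OF constant_dg]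
  dg_prd_closed[OF constant_dg] dg_dinv_closed[OF constant_dg] dg_unit_right[OF constant_dg]
  dg_unit_left[OF constant_dg] dg_inv_right[OF constant_dg] dg_inv_unit[OF constant_dg] constant_str

lemma constant_assoc:
  assumes "l \<in> Lam" "x \<in> carrier H" "y \<in> carrier H" "z \<in> carrier H"
  shows "prd H l (prd H l x y) z = prd H l x (prd H l y z)"
  using dg_assoc[OF constant_dg, of l x y z] assms by (simp add: constant_str)

lemma constant_inv_left:
  assumes "l \<in> Lam" "x \<in> carrier H"
  shows "prd H l (dinv H l x) x = eH"
  using dg_inv_left[OF constant_dg, of l x] assms by (simp add: constant_str)

lemma action_bij: "l \<in> Lam \<Longrightarrow> a \<in> carrier G \<Longrightarrow> bij_betw (Phi l a) (carrier H) (carrier H)"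
  using act by (simp add: dynamical_action_def)

lemma action_closed: "l \<in> Lam \<Longrightarrow> a \<in> carrier G \<Longrightarrow> x \<in> carrier H \<Longrightarrow> Phi l a x \<in> carrier H"
  using action_bij bij_betwE by metis

lemma action_inj:
  assumes "l \<in> Lam" "a \<in> carrier G" "x \<in> carrier H" "y \<in> carrier H" "Phi l a x = Phi l a y"
  shows "x = y"
  using action_bij[OF assms(1,2)] assms(3-) by (meson bij_betw_imp_inj_on inj_onD)

lemma action_inv_closed:
  assumes "l \<in> Lam" "a \<in> carrier G" "x \<in> carrier H"
  shows "inv_into (carrier H) (Phi l a) x \<in> carrier H"
  using action_bij[OF assms(1,2)] assms(3) by (metis bij_betw_imp_surj_on inv_into_into)

lemma action_action_inv:
  assumes "l \<in> Lam" "a \<in> carrier G" "x \<in> carrier H"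
  shows "Phi l a (inv_into (carrier H) (Phi l a) x) = x"
  using action_bij[OF assms(1,2)] assms(3) by (metis bij_betw_inv_into_right)

lemma action_mult:
  "l \<in> Lam \<Longrightarrow> a \<in> carrier G \<Longrightarrow> x \<in> carrier H \<Longrightarrow> y \<in> carrier H \<Longrightarrow>
    Phi l a (prd H (str G l a) x y) = prd H l (Phi l a x) (Phi l a y)"
  using act by (simp add: dynamical_action_def)

lemma action_prd:
  "l \<in> Lam \<Longrightarrow> a \<in> carrier G \<Longrightarrow> b \<in> carrier G \<Longrightarrow> x \<in> carrier H \<Longrightarrow>
    Phi l (prd G l a b) x = Phi l a (Phi (str G l a) b x)"
  using act by (simp add: dynamical_action_def)

text \<open>The multiplicative law at \<open>eG\<close> makes \<open>Phi l eG\<close> idempotent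
  under composition, and an injective idempotent map is the identity.\<close>

lemma action_unit:
  assumes "l \<in> Lam" "x \<in> carrier H"
  shows "Phi l eG x = x"
  using action_prd[of l eG eG x] assms
  by (auto simp: G_simps action_closed intro: action_inj[of l eG])

text \<open>\<open>Phi l a\<close> is a homomorphism from the group at \<open>str G l a\<close> to
  the group at \<open>l\<close>. Both have the unit \<open>eH\<close>, whose image is therefore
  idempotent at \<open>l\<close>.\<close>

lemma action_fixes_unit:
  assumes "l \<in> Lam" "a \<in> carrier G"
  shows "Phi l a eH = eH"
  using dg_idempotent[OF constant_dg, of l "Phi l a eH"] action_mult[of l a eH eH] assms
  by (simp add: G_simps H_simps action_closed)

lemma action_inv_fixes_unit:
  assumes "l \<in> Lam" "a \<in> carrier G"
  shows "inv_into (carrier H) (Phi l a) eH = eH"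
  by (rule action_inj[of l a])
    (simp_all add: assms action_action_inv action_inv_closed H_simps action_fixes_unit)

text \<open>This is the first component of the left inverse law. Applying the injective map
  \<open>Phi l a\<close> moves the product from \<open>str G l a\<close> to \<open>l\<close>, where
  it becomes the inverse of \<open>x\<close> times \<open>x\<close>.\<close>

lemma semidirect_inv_left:
  assumes l: "l \<in> Lam" and a: "a \<in> carrier G" and x: "x \<in> carrier H"
  shows "prd H (str G l a) (inv_into (carrier H) (Phi l a) (dinv H l x))
           (Phi (str G l a) (dinv G l a) x) = eH"
proof (rule action_inj[of l a])
  have "Phi l a (Phi (str G l a) (dinv G l a) x) = x"
    using action_prd[of l a "dinv G l a" x] assms by (simp add: G_simps action_unit)
  then show "Phi l a (prd H (str G l a) (inv_into (carrier H) (Phi l a) (dinv H l x))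
      (Phi (str G l a) (dinv G l a) x)) = Phi l a eH"
    using assms
    by (simp add: action_mult G_simps H_simps action_inv_closed action_closed action_action_inv
        constant_inv_left action_fixes_unit)
qed (use assms in \<open>simp_all add: G_simps H_simps action_inv_closed action_closed\<close>)

lemma semidirect_dynamical_group: "dynamical_group Lam (semidirect H G Phi) (eH, eG)"
  unfolding dynamical_group_def semidirect_def
  by (auto simp: G_simps H_simps action_closed action_inv_closed action_action_inv action_unit
      action_fixes_unit semidirect_inv_left action_mult action_prd constant_assoc dg_assoc[OF G])

section \<open>The structure attached to \<open>B\<close> and its factorization\<close>

context
  fixes B :: "'h \<Rightarrow> 'g"
  assumes B: "B \<in> carrier H \<rightarrow> carrier G"
begin

lemma B_closed: "x \<in> carrier H \<Longrightarrow> B x \<in> carrier G"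
  using B by auto

lemma xi_bij:
  assumes "l \<in> Lam"
  shows "bij_betw (xi G B l) (carrier H \<times> carrier G) (carrier H \<times> carrier G)"
  by (rule bij_betw_byWitness[where f' = "xi_inv G B l"])
    (use assms in \<open>auto simp: xi_def xi_inv_def G_simps B_closed\<close>)

text \<open>Each operation of \<open>rb_struct\<close> is the semi-direct one conjugated by
  \<open>xi\<close>; in the unit, the trailing factor \<open>eG\<close> is absorbed.\<close>

lemma rb_struct_pullback:
  "pullback_dynamical_group Lam (rb_struct H G Phi B) (xi G B) (xi_inv G B)
     (semidirect H G Phi) (eH, eG)"
  unfolding pullback_dynamical_group_def
  using semidirect_dynamical_group xi_bij
  by (auto simp: rb_struct_def semidirect_def xi_def xi_inv_def Let_def G_simps H_simps B_closed)

lemma rota_baxter_if_subgroup: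
  assumes "dynamical_subgroup Lam (rb_struct H G Phi B) (carrier H \<times> {eG})"
  shows "relative_rota_baxter Lam G H Phi B"
  unfolding relative_rota_baxter_def
proof (intro conjI ballI B)
  fix l x y
  assume l: "l \<in> Lam" and x: "x \<in> carrier H" and y: "y \<in> carrier H"
  define z where "z = prd H l x (Phi l (B x) y)"
  have z: "z \<in> carrier H"
    using l x y by (simp add: z_def H_simps action_closed B_closed)
  have "prd (rb_struct H G Phi B) l (x, eG) (y, eG) \<in> carrier H \<times> {eG}"
    using assms l x y unfolding dynamical_subgroup_def by blast
  then have "prd G (str G l (B z)) (dinv G l (B z)) (prd G l (B x) (B y)) = eG"
    using l x y by (simp add: rb_struct_def Let_def G_simps B_closed z_def)
  \<comment> \<open>Multiply by \<open>B z\<close> on the left at \<open>l\<close>.\<close>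
  then have "prd G l (B z) eG = prd G l (B x) (B y)"
    using dg_prd_inv_cancel[OF G, of l "B z" "prd G l (B x) (B y)"] l x y z
    by (simp add: G_simps B_closed)
  then show "prd G l (B x) (B y) = B (prd H l x (Phi l (B x) y))"
    using l z by (simp add: G_simps B_closed z_def)
qed

lemma factorized_if_rota_baxter:
  assumes "relative_rota_baxter Lam G H Phi B"
  shows "factorized_into Lam (rb_struct H G Phi B) (carrier H \<times> {eG}) ({eH} \<times> carrier G)"
proof -
  have rb: "B (prd H l x (Phi l (B x) y)) = prd G l (B x) (B y)"
    if "l \<in> Lam" "x \<in> carrier H" "y \<in> carrier H" for l x y
    using assms that by (simp add: relative_rota_baxter_def)
  \<comment> \<open>The identity at \<open>eH\<close>, \<open>eH\<close> makes \<open>B eH\<close>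
    idempotent. The equation mentions no parameter, but its proof needs one.\<close>
  have B_unit: "B eH = eG" if "l \<in> Lam" for l
    by (rule dg_idempotent[OF G, of l])
      (use rb[of l eH eH] that in \<open>simp_all add: H_simps B_closed action_fixes_unit\<close>)
  \<comment> \<open>The argument \<open>w\<close> of \<open>B\<close> on the left satisfies
    \<open>prd H l x (Phi l (B x) w) = eH\<close>, so the identity gives
    \<open>prd G l (B x) (B w) = B eH = eG\<close>.\<close>
  have B_inv: "B (inv_into (carrier H) (Phi l (B x)) (dinv H l x)) = dinv G l (B x)"
    if "l \<in> Lam" "x \<in> carrier H" for l x
    by (rule sym, rule dg_inv_unique[OF G])
      (use that in \<open>simp_all add: rb[symmetric] H_simps B_closed action_inv_closed
        action_action_inv B_unit[of l]\<close>)
  \<comment> \<open>The left inverse law in the form that survives rewriting \<open>str\<close> of a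
    product as an iterated \<open>str\<close>; it gives closure of the first factor under
    products.\<close>
  have prd_inv_left: "prd G (str G (str G l a) b) (dinv G l (prd G l a b)) (prd G l a b) = eG"
    if "l \<in> Lam" "a \<in> carrier G" "b \<in> carrier G" for l a b
    using dg_inv_left[OF G, of l "prd G l a b"] that by (simp add: G_simps)
  have "dynamical_subgroup Lam (rb_struct H G Phi B) (carrier H \<times> {eG})"
    unfolding dynamical_subgroup_def
    by (auto simp: rb_struct_def Let_def G_simps H_simps B_closed action_closed action_inv_closed
        B_unit B_inv rb prd_inv_left)
  \<comment> \<open>Since \<open>B eH = eG\<close>, the maps \<open>xi\<close> are the identity on
    this set, and the operations there are those of \<open>G\<close>.\<close>
  moreover have "dynamical_subgroup Lam (rb_struct H G Phi B) ({eH} \<times> carrier G)"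
    unfolding dynamical_subgroup_def
    by (auto simp: rb_struct_def Let_def G_simps H_simps B_unit action_fixes_unit
        action_inv_fixes_unit)
  moreover have "\<exists>u\<in>carrier H \<times> {eG}. \<exists>v\<in>{eH} \<times> carrier G. k = prd (rb_struct H G Phi B) l u v"
    if l: "l \<in> Lam" and k: "k \<in> carrier (rb_struct H G Phi B)" for l k
  proof -
    obtain x a where k_eq: "k = (x, a)" and x: "x \<in> carrier H" and a: "a \<in> carrier G"
      using k by (auto simp: rb_struct_def)
    \<comment> \<open>As \<open>Phi l (B x)\<close> fixes \<open>eH\<close>, the first component is
      \<open>x\<close>; in the second, the inverse of \<open>B x\<close> cancels against
      \<open>prd G l (B x) a\<close>.\<close>
    have "k = prd (rb_struct H G Phi B) l (x, eG) (eH, a)"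
      using l x a
      by (simp add: k_eq rb_struct_def Let_def G_simps H_simps B_closed B_unit action_fixes_unit)
    then show ?thesis
      using x a by blast
  qed
  moreover have "carrier H \<times> {eG} \<inter> {eH} \<times> carrier G = {one (rb_struct H G Phi B) l}"
    if "l \<in> Lam" for l
    using that by (auto simp: rb_struct_def G_simps H_simps B_unit)
  ultimately show ?thesis
    unfolding factorized_into_def by blast
qed

end

end

theorem theorem3p7:
  fixes Lam :: "'l set"
    and G :: "('l, 'g) dynamical_struct" and eG :: 'g
    and H :: "('l, 'h) dynamical_struct" and eH :: 'h
    and Phi :: "'l \<Rightarrow> 'g \<Rightarrow> 'h \<Rightarrow> 'h"
    and B :: "'h \<Rightarrow> 'g"
  assumes "dynamical_group Lam G eG"
    and "constant_dynamical_group Lam H eH"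
    and "dynamical_action Lam G H Phi"
    and "B \<in> carrier H \<rightarrow> carrier G"
  shows "pullback_dynamical_group Lam (rb_struct H G Phi B) (xi G B) (xi_inv G B)
           (semidirect H G Phi) (eH, eG) \<and>
         (factorized_into Lam (rb_struct H G Phi B) (carrier H \<times> {eG}) ({eH} \<times> carrier G)
           \<longleftrightarrow> relative_rota_baxter Lam G H Phi B)"
  using rb_struct_pullback[OF assms] rota_baxter_if_subgroup[OF assms]
    factorized_if_rota_baxter[OF assms]
  unfolding factorized_into_def by blast

end
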